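(* Let $\mathbf{FRel}$ be the symmetric monoidal category of finite sets and relations, where each finite set $A$ is equipped with the completely mixed state $\mu_A\colon I\to A$ (relating the point to every element of $A$) and the discarding effect $\varepsilon_A\colon A\to I$ (relating every element of $A$ to the point). The symmetric monoidal subcategory $\mathcal P$ of pure morphisms consists precisely of the partial functions (relations in which everything in the source is related to at most one element of the target). Dually, the symmetric monoidal subcategory $\mathcal C$ of copure morphisms consists precisely of the injective relations (those in which everything in the target is related to at most one element of the source).
   Context: $\mathbf{FRel}$: objects are finite sets, morphisms $A\to B$ are relations $r\subseteq A\times B$ with the usual composition of relations; the monoidal product is the Cartesian product of sets and of relations; the unit $I$ is a one-element set. Lifting: for morphisms $f\colon A\to B$ and $g\colon C\to D$ of a category, $f$ has the lifting property against $g$ when for all $u\colon A\to C$, $v\colon B\to D$ with $g\circ u=v\circ f$ there is $h\colon B\to C$ with $h\circ f=u$ and $g\circ h=v$. In a symmetric monoidal category, $f\oslash g$ means: for all objects $A',B'$, the morphism $f\otimes\mathrm{id}_{A'}$ has the lifting property against $g\otimes\mathrm{id}_{B'}$. For a collection $\mathcal A$ of morphisms, $\mathcal A^{\oslash}=\{g\mid \forall f\in\mathcal A\colon f\oslash g\}$ and ${}^{\oslash}\mathcal A=\{f\mid\forall g\in\mathcal A\colon f\oslash g\}$. Let $\mathcal M'$ be the collection of all completely mixed states $\mu_A$ and $\mathcal D'$ the collection of all discarding effects $\varepsilon_A$ ($A$ ranging over all finite sets). The class of pure morphisms is $\mathcal P=\mathcal M'^{\oslash}$, and the class of copure morphisms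 is $\mathcal C={}^{\oslash}\mathcal D'$.
   Formalization: Completely mixed states and discarding effects range over nonempty finite sets only (with the empty set, pure morphisms would have to be total and the claim fails); finite sets are taken inside one infinite universe closed under pairing, which contains a copy of every finite set. *)

theory Defs
  imports Main
begin

section \<open>Symmetric monoidal categories and monoidal lifting\<close>

text \<open>Only the values of the operations on objects and on (composable) arrows matter;
  elsewhere they are unconstrained.\<close>

record ('o, 'm) monoidal_data =
  obj :: "'o set"
  arr :: "'m set"
  dom :: "'m \<Rightarrow> 'o"
  cod :: "'m \<Rightarrow> 'o"
  ident :: "'o \<Rightarrow> 'm"
  comp :: "'m \<Rightarrow> 'm \<Rightarrow> 'm"  (infixl "\<cdot>\<index>" 70)
  tobj :: "'o \<Rightarrow> 'o \<Rightarrow> 'o"  (infixr "\<otimes>\<^sub>o\<index>" 75)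
  tarr :: "'m \<Rightarrow> 'm \<Rightarrow> 'm"  (infixr "\<otimes>\<index>" 75)
  unit_obj :: "'o"
  assoc :: "'o \<Rightarrow> 'o \<Rightarrow> 'o \<Rightarrow> 'm"
  lunit :: "'o \<Rightarrow> 'm"
  runit :: "'o \<Rightarrow> 'm"
  symm :: "'o \<Rightarrow> 'o \<Rightarrow> 'm"

definition hom :: "('o, 'm, 'z) monoidal_data_scheme \<Rightarrow> 'o \<Rightarrow> 'o \<Rightarrow> 'm set" where
  "hom \<C> A B = {f \<in> arr \<C>. dom \<C> f = A \<and> cod \<C> f = B}"

definition inverse_arrs :: "('o, 'm, 'z) monoidal_data_scheme \<Rightarrow> 'm \<Rightarrow> 'm \<Rightarrow> bool" where
  "inverse_arrs \<C> f g \<longleftrightarrow> f \<in> arr \<C> \<and> g \<in> hom \<C> (cod \<C> f) (dom \<C> f) \<and>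
     g \<cdot>\<^bsub>\<C>\<^esub> f = ident \<C> (dom \<C> f) \<and> f \<cdot>\<^bsub>\<C>\<^esub> g = ident \<C> (cod \<C> f)"

locale sym_monoidal_category =
  fixes \<C> :: "('o, 'm, 'z) monoidal_data_scheme" (structure)
  assumes dom_obj: "f \<in> arr \<C> \<Longrightarrow> dom \<C> f \<in> obj \<C>"
    and cod_obj: "f \<in> arr \<C> \<Longrightarrow> cod \<C> f \<in> obj \<C>"
    and ident_hom: "A \<in> obj \<C> \<Longrightarrow> ident \<C> A \<in> hom \<C> A A"
    and comp_hom: "\<lbrakk>f \<in> hom \<C> A B; g \<in> hom \<C> B D\<rbrakk> \<Longrightarrow> g \<cdot> f \<in> hom \<C> A D"
    and comp_ident: "f \<in> hom \<C> A B \<Longrightarrow> f \<cdot> ident \<C> A = f"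
    and ident_comp: "f \<in> hom \<C> A B \<Longrightarrow> ident \<C> B \<cdot> f = f"
    and comp_assoc: "\<lbrakk>f \<in> hom \<C> A B; g \<in> hom \<C> B D; h \<in> hom \<C> D E\<rbrakk>
      \<Longrightarrow> (h \<cdot> g) \<cdot> f = h \<cdot> (g \<cdot> f)"
    and unit_obj: "unit_obj \<C> \<in> obj \<C>"
    and tobj_obj: "\<lbrakk>A \<in> obj \<C>; B \<in> obj \<C>\<rbrakk> \<Longrightarrow> A \<otimes>\<^sub>o B \<in> obj \<C>"
    and tarr_hom: "\<lbrakk>f \<in> hom \<C> A B; f' \<in> hom \<C> A' B'\<rbrakk>
      \<Longrightarrow> f \<otimes> f' \<in> hom \<C> (A \<otimes>\<^sub>o A') (B \<otimes>\<^sub>o B')"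
    and tarr_ident: "\<lbrakk>A \<in> obj \<C>; B \<in> obj \<C>\<rbrakk>
      \<Longrightarrow> ident \<C> A \<otimes> ident \<C> B = ident \<C> (A \<otimes>\<^sub>o B)"
    and interchange: "\<lbrakk>f \<in> hom \<C> A B; g \<in> hom \<C> B D; f' \<in> hom \<C> A' B'; g' \<in> hom \<C> B' D'\<rbrakk>
      \<Longrightarrow> (g \<cdot> f) \<otimes> (g' \<cdot> f') = (g \<otimes> g') \<cdot> (f \<otimes> f')"
    and assoc_hom: "\<lbrakk>A \<in> obj \<C>; B \<in> obj \<C>; D \<in> obj \<C>\<rbrakk>
      \<Longrightarrow> assoc \<C> A B D \<in> hom \<C> ((A \<otimes>\<^sub>o B) \<otimes>\<^sub>o D) (A \<otimes>\<^sub>o (B \<otimes>\<^sub>o D))"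
    and assoc_iso: "\<lbrakk>A \<in> obj \<C>; B \<in> obj \<C>; D \<in> obj \<C>\<rbrakk>
      \<Longrightarrow> \<exists>g. inverse_arrs \<C> (assoc \<C> A B D) g"
    and assoc_natural: "\<lbrakk>f \<in> hom \<C> A A'; g \<in> hom \<C> B B'; h \<in> hom \<C> D D'\<rbrakk>
      \<Longrightarrow> assoc \<C> A' B' D' \<cdot> ((f \<otimes> g) \<otimes> h) = (f \<otimes> (g \<otimes> h)) \<cdot> assoc \<C> A B D"
    and lunit_hom: "A \<in> obj \<C> \<Longrightarrow> lunit \<C> A \<in> hom \<C> (unit_obj \<C> \<otimes>\<^sub>o A) A"
    and lunit_iso: "A \<in> obj \<C> \<Longrightarrow> \<exists>g. inverse_arrs \<C> (lunit \<C> A) g"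
    and lunit_natural: "f \<in> hom \<C> A B
      \<Longrightarrow> lunit \<C> B \<cdot> (ident \<C> (unit_obj \<C>) \<otimes> f) = f \<cdot> lunit \<C> A"
    and runit_hom: "A \<in> obj \<C> \<Longrightarrow> runit \<C> A \<in> hom \<C> (A \<otimes>\<^sub>o unit_obj \<C>) A"
    and runit_iso: "A \<in> obj \<C> \<Longrightarrow> \<exists>g. inverse_arrs \<C> (runit \<C> A) g"
    and runit_natural: "f \<in> hom \<C> A B
      \<Longrightarrow> runit \<C> B \<cdot> (f \<otimes> ident \<C> (unit_obj \<C>)) = f \<cdot> runit \<C> A"
    and symm_hom: "\<lbrakk>A \<in> obj \<C>; B \<in> obj \<C>\<rbrakk> \<Longrightarrow> symm \<C> A B \<in> hom \<C> (A \<otimes>\<^sub>o B) (B \<otimes>\<^sub>o A)"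
    and symm_symm: "\<lbrakk>A \<in> obj \<C>; B \<in> obj \<C>\<rbrakk>
      \<Longrightarrow> symm \<C> B A \<cdot> symm \<C> A B = ident \<C> (A \<otimes>\<^sub>o B)"
    and symm_natural: "\<lbrakk>f \<in> hom \<C> A A'; g \<in> hom \<C> B B'\<rbrakk>
      \<Longrightarrow> symm \<C> A' B' \<cdot> (f \<otimes> g) = (g \<otimes> f) \<cdot> symm \<C> A B"
    and triangle: "\<lbrakk>A \<in> obj \<C>; B \<in> obj \<C>\<rbrakk>
      \<Longrightarrow> (ident \<C> A \<otimes> lunit \<C> B) \<cdot> assoc \<C> A (unit_obj \<C>) B = runit \<C> A \<otimes> ident \<C> B"
    and pentagon: "\<lbrakk>A \<in> obj \<C>; B \<in> obj \<C>; D \<in> obj \<C>; E \<in> obj \<C>\<rbrakk>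
      \<Longrightarrow> (ident \<C> A \<otimes> assoc \<C> B D E) \<cdot> assoc \<C> A (B \<otimes>\<^sub>o D) E \<cdot> (assoc \<C> A B D \<otimes> ident \<C> E)
          = assoc \<C> A B (D \<otimes>\<^sub>o E) \<cdot> assoc \<C> (A \<otimes>\<^sub>o B) D E"
    and hexagon: "\<lbrakk>A \<in> obj \<C>; B \<in> obj \<C>; D \<in> obj \<C>\<rbrakk>
      \<Longrightarrow> assoc \<C> B D A \<cdot> symm \<C> A (B \<otimes>\<^sub>o D) \<cdot> assoc \<C> A B D
          = (ident \<C> B \<otimes> symm \<C> A D) \<cdot> assoc \<C> B A D \<cdot> (symm \<C> A B \<otimes> ident \<C> D)"

text \<open>Subcategories are wide: they contain all objects.\<close>

definition sym_monoidal_subcategory :: "('o, 'm, 'z) monoidal_data_scheme \<Rightarrow> 'm set \<Rightarrow> bool" where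
  "sym_monoidal_subcategory \<C> S \<longleftrightarrow> S \<subseteq> arr \<C> \<and>
     (\<forall>A \<in> obj \<C>. ident \<C> A \<in> S) \<and>
     (\<forall>f \<in> S. \<forall>g \<in> S. dom \<C> g = cod \<C> f \<longrightarrow> g \<cdot>\<^bsub>\<C>\<^esub> f \<in> S) \<and>
     (\<forall>f \<in> S. \<forall>g \<in> S. f \<otimes>\<^bsub>\<C>\<^esub> g \<in> S) \<and>
     (\<forall>A \<in> obj \<C>. \<forall>B \<in> obj \<C>. \<forall>D \<in> obj \<C>.
        assoc \<C> A B D \<in> S \<and> (\<forall>g. inverse_arrs \<C> (assoc \<C> A B D) g \<longrightarrow> g \<in> S)) \<and>
     (\<forall>A \<in> obj \<C>. lunit \<C> A \<in> S \<and> (\<forall>g. inverse_arrs \<C> (lunit \<C> A) g \<longrightarrow> g \<in> S)) \<and>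
     (\<forall>A \<in> obj \<C>. runit \<C> A \<in> S \<and> (\<forall>g. inverse_arrs \<C> (runit \<C> A) g \<longrightarrow> g \<in> S)) \<and>
     (\<forall>A \<in> obj \<C>. \<forall>B \<in> obj \<C>. symm \<C> A B \<in> S)"

definition lifts_against :: "('o, 'm, 'z) monoidal_data_scheme \<Rightarrow> 'm \<Rightarrow> 'm \<Rightarrow> bool" where
  "lifts_against \<C> f g \<longleftrightarrow>
     (\<forall>u \<in> hom \<C> (dom \<C> f) (dom \<C> g). \<forall>v \<in> hom \<C> (cod \<C> f) (cod \<C> g).
        g \<cdot>\<^bsub>\<C>\<^esub> u = v \<cdot>\<^bsub>\<C>\<^esub> f \<longrightarrow>
        (\<exists>h \<in> hom \<C> (cod \<C> f) (dom \<C> g). h \<cdot>\<^bsub>\<C>\<^esub> f = u \<and> g \<cdot>\<^bsub>\<C>\<^esub> h = v))"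

definition oslash :: "('o, 'm, 'z) monoidal_data_scheme \<Rightarrow> 'm \<Rightarrow> 'm \<Rightarrow> bool" where
  "oslash \<C> f g \<longleftrightarrow>
     (\<forall>A' \<in> obj \<C>. \<forall>B' \<in> obj \<C>.
        lifts_against \<C> (f \<otimes>\<^bsub>\<C>\<^esub> ident \<C> A') (g \<otimes>\<^bsub>\<C>\<^esub> ident \<C> B'))"

definition right_oslash :: "('o, 'm, 'z) monoidal_data_scheme \<Rightarrow> 'm set \<Rightarrow> 'm set" where
  "right_oslash \<C> \<A> = {g \<in> arr \<C>. \<forall>f \<in> \<A>. oslash \<C> f g}"

definition left_oslash :: "('o, 'm, 'z) monoidal_data_scheme \<Rightarrow> 'm set \<Rightarrow> 'm set" where
  "left_oslash \<C> \<A> = {f \<in> arr \<C>. \<forall>g \<in> \<A>. oslash \<C> f g}"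


section \<open>Finite sets and relations\<close>

text \<open>The objects are the finite sets with elements in a universe that contains an arbitrary
  type of atoms and a point, and is closed under ordered pairs. So every finite set over any
  type occurs as an object, and the tensor of objects is their Cartesian product.\<close>

datatype 'a elt = Atom 'a | Point | Tup "'a elt" "'a elt"

text \<open>A morphism records its source and target along with its graph.\<close>

datatype 'a rel_arr =
  Rel (src: "'a elt set") (graph: "('a elt \<times> 'a elt) set") (tgt: "'a elt set")

definition cart :: "'a elt set \<Rightarrow> 'a elt set \<Rightarrow> 'a elt set" where
  "cart A B = {Tup a b |a b. a \<in> A \<and> b \<in> B}"

definition FRel :: "('a elt set, 'a rel_arr) monoidal_data" where
  "FRel = \<lparr>
     obj = {A. finite A},
     arr = {f. finite (src f) \<and> finite (tgt f) \<and> graph f \<subseteq> src f \<times> tgt f},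
     dom = src,
     cod = tgt,
     ident = (\<lambda>A. Rel A (Id_on A) A),
     comp = (\<lambda>g f. Rel (src f) (graph f O graph g) (tgt g)),
     tobj = cart,
     tarr = (\<lambda>f g. Rel (cart (src f) (src g))
               {(Tup a c, Tup b d) |a b c d. (a, b) \<in> graph f \<and> (c, d) \<in> graph g}
               (cart (tgt f) (tgt g))),
     unit_obj = {Point},
     assoc = (\<lambda>A B C. Rel (cart (cart A B) C)
               {(Tup (Tup a b) c, Tup a (Tup b c)) |a b c. a \<in> A \<and> b \<in> B \<and> c \<in> C}
               (cart A (cart B C))),
     lunit = (\<lambda>A. Rel (cart {Point} A) {(Tup Point a, a) |a. a \<in> A} A),
     runit = (\<lambda>A. Rel (cart A {Point}) {(Tup a Point, a) |a. a \<in> A} A),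
     symm = (\<lambda>A B. Rel (cart A B) {(Tup a b, Tup b a) |a b. a \<in> A \<and> b \<in> B} (cart B A))
   \<rparr>"

lemma finite_cart: "finite A \<Longrightarrow> finite B \<Longrightarrow> finite (cart A B)"
proof -
  have "cart A B = (\<lambda>(a, b). Tup a b) ` (A \<times> B)" by (auto simp: cart_def)
  then show "finite A \<Longrightarrow> finite B \<Longrightarrow> finite (cart A B)" by simp
qed

lemma rel_arr_eqI: "src f = src g \<Longrightarrow> graph f = graph g \<Longrightarrow> tgt f = tgt g \<Longrightarrow> f = g"
  by (cases f; cases g) simp

definition converse_arr :: "'a rel_arr \<Rightarrow> 'a rel_arr" where
  "converse_arr f = Rel (tgt f) ((graph f)\<inverse>) (src f)"

lemma inverse_converse_arr:
  assumes "f \<in> arr FRel" and "graph f O (graph f)\<inverse> = Id_on (src f)"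
    and "(graph f)\<inverse> O graph f = Id_on (tgt f)"
  shows "\<exists>g. inverse_arrs FRel f g"
  using assms by (intro exI[of _ "converse_arr f"])
    (auto simp: inverse_arrs_def hom_def FRel_def converse_arr_def)

lemma sym_monoidal_category_FRel:
  "sym_monoidal_category (FRel :: ('a elt set, 'a rel_arr) monoidal_data)"
proof
  fix A B D :: "'a elt set"
  assume o: "A \<in> obj FRel" "B \<in> obj FRel" "D \<in> obj FRel"
  show "\<exists>g. inverse_arrs FRel (assoc FRel A B D) g"
    by (rule inverse_converse_arr; use o in \<open>auto simp: FRel_def finite_cart\<close>; auto simp: cart_def)
next
  fix A :: "'a elt set"
  assume o: "A \<in> obj FRel"
  show "\<exists>g. inverse_arrs FRel (lunit FRel A) g"
    by (rule inverse_converse_arr; use o in \<open>auto simp: FRel_def finite_cart\<close>; auto simp: cart_def)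
  show "\<exists>g. inverse_arrs FRel (runit FRel A) g"
    by (rule inverse_converse_arr; use o in \<open>auto simp: FRel_def finite_cart\<close>; auto simp: cart_def)
qed ((auto simp: hom_def FRel_def finite_cart intro!: rel_arr_eqI)[1]; (auto simp: cart_def relcomp_unfold; blast?)?)+


section \<open>Pure and copure morphisms\<close>

definition mixed :: "'a elt set \<Rightarrow> 'a rel_arr" where
  "mixed A = Rel {Point} ({Point} \<times> A) A"

definition discard :: "'a elt set \<Rightarrow> 'a rel_arr" where
  "discard A = Rel A (A \<times> {Point}) {Point}"

text \<open>The empty set is left out here, although it is an object of \<open>FRel\<close>: the state
  \<^term>\<open>mixed {}\<close> and the effect \<^term>\<open>discard {}\<close> are zero morphisms, and lifting against them
  would exclude the partial functions that are not total and the injective relations that are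
  not surjective, see the two lemmas at the end.\<close>

definition mixed_states :: "'a rel_arr set" where
  "mixed_states = {mixed A |A. finite A \<and> A \<noteq> {}}"

definition discardings :: "'a rel_arr set" where
  "discardings = {discard A |A. finite A \<and> A \<noteq> {}}"

definition pure :: "'a rel_arr set" where
  "pure = right_oslash FRel mixed_states"

definition copure :: "'a rel_arr set" where
  "copure = left_oslash FRel discardings"

definition partial_functions :: "'a rel_arr set" where
  "partial_functions = {f \<in> arr FRel. \<forall>a \<in> src f. \<forall>b \<in> tgt f. \<forall>b' \<in> tgt f.
     (a, b) \<in> graph f \<and> (a, b') \<in> graph f \<longrightarrow> b = b'}"

definition injective_relations :: "'a rel_arr set" where
  "injective_relations = {f \<in> arr FRel. \<forall>b \<in> tgt f. \<forall>a \<in> src f. \<forall>a' \<in> src f.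
     (a, b) \<in> graph f \<and> (a', b) \<in> graph f \<longrightarrow> a = a'}"

lemma partial_function_not_pure_with_empty:
  defines "g \<equiv> Rel {Point} {} {}"
  shows "g \<in> partial_functions" and "g \<notin> right_oslash FRel {mixed A |A. finite A}"
proof -
  show "g \<in> partial_functions" by (simp add: g_def partial_functions_def FRel_def)
  let ?I = "{Point}" and ?P = "Tup Point Point"
  let ?f = "mixed {} \<otimes>\<^bsub>FRel\<^esub> ident FRel ?I" and ?g = "g \<otimes>\<^bsub>FRel\<^esub> ident FRel ?I"
  let ?u = "Rel {?P} {(?P, ?P)} {?P}" and ?v = "Rel {} {} {}"
  have "?u \<in> hom FRel (dom FRel ?f) (dom FRel ?g)" "?v \<in> hom FRel (cod FRel ?f) (cod FRel ?g)"
    "?g \<cdot>\<^bsub>FRel\<^esub> ?u = ?v \<cdot>\<^bsub>FRel\<^esub> ?f" "\<And>h. h \<cdot>\<^bsub>FRel\<^esub> ?f \<noteq> ?u"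
    by (auto simp: g_def mixed_def FRel_def hom_def cart_def)
  then have "\<not> lifts_against FRel ?f ?g" unfolding lifts_against_def by blast
  moreover have "?I \<in> obj FRel" by (simp add: FRel_def)
  ultimately have "\<not> oslash FRel (mixed {}) g" unfolding oslash_def by blast
  then show "g \<notin> right_oslash FRel {mixed A |A. finite A}" unfolding right_oslash_def by blast
qed

lemma injective_relation_not_copure_with_empty:
  defines "f \<equiv> Rel {} {} {Point}"
  shows "f \<in> injective_relations" and "f \<notin> left_oslash FRel {discard A |A. finite A}"
proof -
  show "f \<in> injective_relations" by (simp add: f_def injective_relations_def FRel_def)
  let ?I = "{Point}" and ?P = "Tup Point Point"
  let ?f = "f \<otimes>\<^bsub>FRel\<^esub> ident FRel ?I" and ?g = "discard {} \<otimes>\<^bsub>FRel\<^esub> ident FRel ?I"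
  let ?u = "Rel {} {} {}" and ?v = "Rel {?P} {(?P, ?P)} {?P}"
  have "?u \<in> hom FRel (dom FRel ?f) (dom FRel ?g)" "?v \<in> hom FRel (cod FRel ?f) (cod FRel ?g)"
    "?g \<cdot>\<^bsub>FRel\<^esub> ?u = ?v \<cdot>\<^bsub>FRel\<^esub> ?f" "\<And>h. ?g \<cdot>\<^bsub>FRel\<^esub> h \<noteq> ?v"
    by (auto simp: f_def discard_def FRel_def hom_def cart_def)
  then have "\<not> lifts_against FRel ?f ?g" unfolding lifts_against_def by blast
  moreover have "?I \<in> obj FRel" by (simp add: FRel_def)
  ultimately have "\<not> oslash FRel f (discard {})" unfolding oslash_def by blast
  then show "f \<notin> left_oslash FRel {discard A |A. finite A}" unfolding left_oslash_def by blast
qed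

end

theory Submission
  imports Defs
begin

text \<open>If \<open>f\<close> is total, surjective and injective as a relation (as \<open>\<mu> \<otimes> id\<close> is for a mixed state
  \<open>\<mu>\<close> of a nonempty set) and \<open>g\<close> is a partial function, then a square \<open>g \<circ> u = v \<circ> f\<close> has the
  largest possible filler: relate \<open>y\<close> to every \<open>c\<close> in the image under \<open>u\<close> of the preimage of \<open>y\<close>
  whose value under \<open>g\<close>, if defined, lies in \<open>v y\<close>. Conversely, if \<open>g\<close> relates \<open>c\<close> to two elements
  \<open>d \<noteq> d'\<close>, then one splits the image of \<open>c\<close> into \<open>{d}\<close> and the rest; a filler for the state of
  \<open>{d, d'}\<close> would need a subset of \<open>{c}\<close> with image \<open>{d}\<close>. Taking converse relations exchanges
  states with effects and reverses lifting, which gives the dual statement.\<close>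

section \<open>Arrows of \<open>FRel\<close> as relations\<close>

lemma FRel_simps [simp]:
  "A \<in> obj FRel \<longleftrightarrow> finite A"
  "f \<in> arr FRel \<longleftrightarrow> finite (src f) \<and> finite (tgt f) \<and> graph f \<subseteq> src f \<times> tgt f"
  "dom FRel = src"
  "cod FRel = tgt"
  "ident FRel A = Rel A (Id_on A) A"
  "g \<cdot>\<^bsub>FRel\<^esub> f = Rel (src f) (graph f O graph g) (tgt g)"
  "f \<otimes>\<^bsub>FRel\<^esub> g = Rel (cart (src f) (src g))
     {(Tup a c, Tup b d) |a b c d. (a, b) \<in> graph f \<and> (c, d) \<in> graph g}
     (cart (tgt f) (tgt g))"
  by (simp_all add: FRel_def)

lemma in_hom_FRel:
  "f \<in> hom FRel A B \<longleftrightarrow> src f = A \<and> tgt f = B \<and> finite A \<and> finite B \<and> graph f \<subseteq> A \<times> B"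
  by (auto simp: hom_def)

lemma Tup_in_cart [simp]: "Tup a b \<in> cart A B \<longleftrightarrow> a \<in> A \<and> b \<in> B"
  by (auto simp: cart_def)

section \<open>Isomorphisms and symmetric monoidal subcategories\<close>

lemma inverse_arrs_sym:
  "inverse_arrs \<C> f g \<Longrightarrow> inverse_arrs \<C> g f"
  by (auto simp: inverse_arrs_def hom_def)

text \<open>Identities, associators, unitors, their inverses and symmetries are all isomorphisms, so
  one condition on isomorphisms covers them without unfolding the coherence data.\<close>

lemma (in sym_monoidal_category) sym_monoidal_subcategoryI:
  assumes "S \<subseteq> arr \<C>"
    and iso: "\<And>f g. inverse_arrs \<C> f g \<Longrightarrow> f \<in> S"
    and "\<And>f g. \<lbrakk>f \<in> S; g \<in> S; dom \<C> g = cod \<C> f\<rbrakk> \<Longrightarrow> g \<cdot> f \<in> S"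
    and "\<And>f g. \<lbrakk>f \<in> S; g \<in> S\<rbrakk> \<Longrightarrow> f \<otimes> g \<in> S"
  shows "sym_monoidal_subcategory \<C> S"
proof -
  have "inverse_arrs \<C> (ident \<C> A) (ident \<C> A)" if "A \<in> obj \<C>" for A
    using ident_hom[OF that] comp_ident[OF ident_hom[OF that]]
    by (auto simp: inverse_arrs_def hom_def)
  moreover have "inverse_arrs \<C> (symm \<C> A B) (symm \<C> B A)" if "A \<in> obj \<C>" "B \<in> obj \<C>" for A B
    using that symm_hom[of A B] symm_hom[of B A] symm_symm[of A B] symm_symm[of B A]
    by (auto simp: inverse_arrs_def hom_def)
  ultimately show ?thesis
    unfolding sym_monoidal_subcategory_def
    using assms assoc_iso lunit_iso runit_iso inverse_arrs_sym
    by (smt (verit))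
qed

text \<open>An isomorphism of relations is a bijection; hence both classes contain all isomorphisms,
  as the subcategory criterion demands.\<close>

lemma inverse_arrs_FRel_single_valued:
  assumes "inverse_arrs FRel f g"
  shows "single_valued (graph f)" and "single_valued ((graph f)\<inverse>)"
proof -
  have fg: "graph f O graph g = Id_on (src f)" and gf: "graph g O graph f = Id_on (tgt f)"
    and sub: "graph f \<subseteq> src f \<times> tgt f"
    using assms by (auto simp: inverse_arrs_def)
  show "single_valued (graph f)"
  proof (rule single_valuedI)
    fix a b b'
    assume ab: "(a, b) \<in> graph f" "(a, b') \<in> graph f"
    then have "(a, a) \<in> graph f O graph g" using fg sub by auto
    then obtain c where "(c, a) \<in> graph g" by auto
    \<comment> \<open>Passing from \<open>c\<close> through \<open>a\<close> reaches both
      \<open>b\<close> and \<open>b'\<close>, but this composite is an identity, so both equal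
      \<open>c\<close>.\<close>
    then have "(c, b) \<in> Id_on (tgt f)" "(c, b') \<in> Id_on (tgt f)" using ab gf by blast+
    then show "b = b'" by auto
  qed
  show "single_valued ((graph f)\<inverse>)"
  proof (rule single_valuedI)
    fix b a a'
    assume ab: "(b, a) \<in> (graph f)\<inverse>" "(b, a') \<in> (graph f)\<inverse>"
    then have "(b, b) \<in> graph g O graph f" using gf sub by auto
    then obtain c where "(b, c) \<in> graph g" by auto
    then have "(a, c) \<in> Id_on (src f)" "(a', c) \<in> Id_on (src f)" using ab fg by blast+
    then show "a = a'" by auto
  qed
qed

lemma partial_functions_iff:
  "f \<in> partial_functions \<longleftrightarrow> f \<in> arr FRel \<and> single_valued (graph f)"
  by (auto simp: partial_functions_def single_valued_def)

lemma injective_relations_iff: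
  "f \<in> injective_relations \<longleftrightarrow> f \<in> arr FRel \<and> single_valued ((graph f)\<inverse>)"
  by (auto simp: injective_relations_def single_valued_def)

lemma sym_monoidal_subcategory_partial_functions:
  "sym_monoidal_subcategory (FRel :: ('a elt set, 'a rel_arr) monoidal_data) partial_functions"
proof (rule sym_monoidal_category.sym_monoidal_subcategoryI[OF sym_monoidal_category_FRel])
  show "f \<in> partial_functions" if "inverse_arrs FRel f g" for f g :: "'a rel_arr"
    using that inverse_arrs_FRel_single_valued(1)[OF that]
    by (simp add: partial_functions_iff inverse_arrs_def)
  show "g \<cdot>\<^bsub>FRel\<^esub> f \<in> partial_functions"
    if "f \<in> partial_functions" "g \<in> partial_functions" "dom FRel g = cod FRel f"
    for f g :: "'a rel_arr"
    using that by (auto simp: partial_functions_iff single_valued_relcomp)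
  show "f \<otimes>\<^bsub>FRel\<^esub> g \<in> partial_functions"
    if "f \<in> partial_functions" "g \<in> partial_functions" for f g :: "'a rel_arr"
    using that by (auto simp: partial_functions_iff finite_cart single_valued_def)
qed (auto simp: partial_functions_iff)

lemma sym_monoidal_subcategory_injective_relations:
  "sym_monoidal_subcategory (FRel :: ('a elt set, 'a rel_arr) monoidal_data) injective_relations"
proof (rule sym_monoidal_category.sym_monoidal_subcategoryI[OF sym_monoidal_category_FRel])
  show "f \<in> injective_relations" if "inverse_arrs FRel f g" for f g :: "'a rel_arr"
    using that inverse_arrs_FRel_single_valued(2)[OF that]
    by (simp add: injective_relations_iff inverse_arrs_def)
  show "g \<cdot>\<^bsub>FRel\<^esub> f \<in> injective_relations"
    if "f \<in> injective_relations" "g \<in> injective_relations" "dom FRel g = cod FRel f"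
    for f g :: "'a rel_arr"
    using that by (auto simp: injective_relations_iff converse_relcomp single_valued_relcomp)
  show "f \<otimes>\<^bsub>FRel\<^esub> g \<in> injective_relations"
    if "f \<in> injective_relations" "g \<in> injective_relations" for f g :: "'a rel_arr"
    using that by (auto simp: injective_relations_iff finite_cart single_valued_def)
qed (auto simp: injective_relations_iff)

section \<open>Fillers of squares and pure morphisms\<close>

lemma relation_lifting:
  assumes inj: "single_valued (F\<inverse>)" and G: "single_valued G"
    and total: "\<And>x c. (x, c) \<in> u \<Longrightarrow> x \<in> Domain F"
    and onto: "\<And>y d. (y, d) \<in> v \<Longrightarrow> y \<in> Range F"
    and square: "u O G = F O v"
  defines "h \<equiv> {(y, c). (\<exists>x. (x, y) \<in> F \<and> (x, c) \<in> u) \<and> (\<forall>d. (c, d) \<in> G \<longrightarrow> (y, d) \<in> v)}"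
  shows "F O h = u" and "h O G = v"
proof -
  show "F O h = u"
  proof (intro equalityI subrelI)
    fix x c assume "(x, c) \<in> F O h"
    \<comment> \<open>The preimage of \<open>y\<close> under \<open>F\<close> is a single point, so
      the witness in \<open>h\<close> is \<open>x\<close> itself.\<close>
    then show "(x, c) \<in> u" using inj by (auto simp: h_def single_valued_def)
  next
    fix x c assume xc: "(x, c) \<in> u"
    show "(x, c) \<in> F O h"
    proof (cases "c \<in> Domain G")
      case True
      then obtain d where d: "(c, d) \<in> G" by auto
      then have "(x, d) \<in> F O v" using xc square by blast
      \<comment> \<open>This \<open>y\<close> is chosen so that \<open>v\<close> allows the value
        \<open>d\<close>; as \<open>c\<close> has no other value, \<open>h\<close> relates
        \<open>y\<close> to \<open>c\<close>.\<close>
      then obtain y where "(x, y) \<in> F" "(y, d) \<in> v" by auto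
      then have "(y, c) \<in> h" using xc d G by (auto simp: h_def single_valued_def)
      with \<open>(x, y) \<in> F\<close> show ?thesis by blast
    next
      case False
      \<comment> \<open>Without a value of \<open>c\<close> the condition on \<open>v\<close> is
        vacuous, so any \<open>y\<close> related to \<open>x\<close> serves.\<close>
      with total[OF xc] xc show ?thesis by (auto simp: h_def)
    qed
  qed
  show "h O G = v"
  proof (intro equalityI subrelI)
    fix y d assume "(y, d) \<in> h O G"
    then show "(y, d) \<in> v" by (auto simp: h_def)
  next
    fix y d assume yd: "(y, d) \<in> v"
    then obtain x where x: "(x, y) \<in> F" using onto by blast
    then obtain c where "(x, c) \<in> u" "(c, d) \<in> G" using yd square by blast
    moreover from this have "(y, c) \<in> h" using x yd G by (auto simp: h_def single_valued_def)
    ultimately show "(y, d) \<in> h O G" by blast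
  qed
qed

text \<open>As \<open>f\<close> misses no element of its source or target, the domain and range
  conditions of \<open>relation_lifting\<close> hold for every \<open>u\<close> and
  \<open>v\<close>.\<close>

lemma lifts_against_FRelI:
  assumes f: "single_valued ((graph f)\<inverse>)" "Domain (graph f) = src f" "Range (graph f) = tgt f"
    and g: "single_valued (graph g)"
  shows "lifts_against FRel f g"
  unfolding lifts_against_def
proof (intro ballI impI)
  fix u v
  assume u: "u \<in> hom FRel (dom FRel f) (dom FRel g)"
    and v: "v \<in> hom FRel (cod FRel f) (cod FRel g)"
    and square: "g \<cdot>\<^bsub>FRel\<^esub> u = v \<cdot>\<^bsub>FRel\<^esub> f"
  define h where "h = {(y, c). (\<exists>x. (x, y) \<in> graph f \<and> (x, c) \<in> graph u) \<and>
    (\<forall>d. (c, d) \<in> graph g \<longrightarrow> (y, d) \<in> graph v)}"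
  have eq: "graph u O graph g = graph f O graph v" using square by simp
  have dom: "x \<in> Domain (graph f)" if "(x, c) \<in> graph u" for x c
    using that u f by (auto simp: in_hom_FRel)
  have ran: "y \<in> Range (graph f)" if "(y, d) \<in> graph v" for y d
    using that v f by (auto simp: in_hom_FRel)
  have fill: "graph f O h = graph u" "h O graph g = graph v"
    using relation_lifting[OF f(1) g dom ran eq] by (simp_all add: h_def)
  have "h \<subseteq> tgt f \<times> src g"
    using u f(3) by (auto simp: h_def in_hom_FRel)
  then have "Rel (tgt f) h (src g) \<in> hom FRel (cod FRel f) (dom FRel g)"
    using u v by (auto simp: in_hom_FRel)
  moreover have "Rel (tgt f) h (src g) \<cdot>\<^bsub>FRel\<^esub> f = u" "g \<cdot>\<^bsub>FRel\<^esub> Rel (tgt f) h (src g) = v"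
    using u v fill by (auto simp: in_hom_FRel intro!: rel_arr_eqI)
  ultimately show "\<exists>h\<in>hom FRel (cod FRel f) (dom FRel g). h \<cdot>\<^bsub>FRel\<^esub> f = u \<and> g \<cdot>\<^bsub>FRel\<^esub> h = v"
    by blast
qed

lemma partial_functions_subset_pure: "partial_functions \<subseteq> pure"
proof
  fix g :: "'a rel_arr"
  assume g: "g \<in> partial_functions"
  \<comment> \<open>A nonempty \<open>A\<close> makes the tensored state total, and the second
    component of a pair determines its only preimage.\<close>
  have "lifts_against FRel (mixed A \<otimes>\<^bsub>FRel\<^esub> ident FRel A') (g \<otimes>\<^bsub>FRel\<^esub> ident FRel B')"
    if "A \<noteq> {}" for A A' B'
    by (rule lifts_against_FRelI)
      (use that g in \<open>auto simp: mixed_def cart_def partial_functions_iff single_valued_def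
        Domain_iff Range_iff Id_on_iff\<close>)
  then show "g \<in> pure"
    \<comment> \<open>Identities and tensors stay folded so that the goal matches the fact just
      proved.\<close>
    using g by (auto simp: pure_def right_oslash_def mixed_states_def oslash_def partial_functions_iff
        simp del: FRel_simps(5,7))
qed

lemma pure_subset_partial_functions: "pure \<subseteq> partial_functions"
proof
  fix g :: "'a rel_arr"
  assume g: "g \<in> pure"
  then have arr: "g \<in> arr FRel" by (simp add: pure_def right_oslash_def)
  have "d = d'" if cd: "(c, d) \<in> graph g" and cd': "(c, d') \<in> graph g" for c d d'
  proof (rule ccontr)
    assume neq: "d \<noteq> d'"
    \<comment> \<open>Tensoring with a one-point set only pairs each element with
      \<open>Point\<close>, so this instance is lifting for \<open>mixed {d, d'}\<close> and
      \<open>g\<close> themselves.\<close>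
    let ?I = "{Point}"
    let ?f = "mixed {d, d'} \<otimes>\<^bsub>FRel\<^esub> ident FRel ?I" and ?g = "g \<otimes>\<^bsub>FRel\<^esub> ident FRel ?I"
    let ?u = "Rel (src ?f) {(Tup Point Point, Tup c Point)} (src ?g)"
    \<comment> \<open>The rows of \<open>d\<close> and \<open>d'\<close> together give the whole
      image of \<open>c\<close>, so the square commutes; only the row of \<open>d'\<close> contains
      \<open>d'\<close>.\<close>
    let ?v = "Rel (tgt ?f)
      (insert (Tup d Point, Tup d Point)
        {(Tup d' Point, Tup e Point) |e. (c, e) \<in> graph g \<and> e \<noteq> d}) (tgt ?g)"
    have "oslash FRel (mixed {d, d'}) g"
      using g unfolding pure_def right_oslash_def mixed_states_def by blast
    moreover have "?I \<in> obj FRel" by simp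
    ultimately have "lifts_against FRel ?f ?g" unfolding oslash_def by blast
    moreover have "?u \<in> hom FRel (dom FRel ?f) (dom FRel ?g)"
      using arr cd by (auto simp: in_hom_FRel mixed_def finite_cart)
    moreover have "?v \<in> hom FRel (cod FRel ?f) (cod FRel ?g)"
      using arr cd by (auto simp: in_hom_FRel mixed_def finite_cart)
    moreover have "?g \<cdot>\<^bsub>FRel\<^esub> ?u = ?v \<cdot>\<^bsub>FRel\<^esub> ?f"
      using cd neq by (auto simp: mixed_def relcomp_unfold Id_on_iff)
    ultimately obtain h where fh: "h \<cdot>\<^bsub>FRel\<^esub> ?f = ?u" and hg: "?g \<cdot>\<^bsub>FRel\<^esub> h = ?v"
      unfolding lifts_against_def by blast
    have graph_fh: "graph ?f O graph h = graph ?u" using arg_cong[OF fh, of graph] by simp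
    have graph_hg: "graph h O graph ?g = graph ?v" using arg_cong[OF hg, of graph] by simp
    have "(Tup d Point, Tup d Point) \<in> graph h O graph ?g"
      unfolding graph_hg by simp
    then obtain x where x: "(Tup d Point, x) \<in> graph h" by blast
    moreover have "(Tup Point Point, Tup d Point) \<in> graph ?f" by (auto simp: mixed_def)
    ultimately have "(Tup Point Point, x) \<in> graph ?u" unfolding graph_fh[symmetric] by blast
    \<comment> \<open>The upper triangle forces \<open>h\<close> to send \<open>d\<close> to
      \<open>c\<close> alone, so the lower one puts the unwanted \<open>d'\<close> into the row of
      \<open>d\<close>.\<close>
    then have "x = Tup c Point" by simp
    moreover have "(Tup c Point, Tup d' Point) \<in> graph ?g" using cd' by auto
    ultimately have "(Tup d Point, Tup d' Point) \<in> graph ?v"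
      using x unfolding graph_hg[symmetric] by blast
    then show False using neq by simp
  qed
  then show "g \<in> partial_functions"
    using arr by (simp add: partial_functions_iff single_valued_def)
qed

section \<open>Duality by converse relations\<close>

lemma converse_arr_simps [simp]:
  "src (converse_arr f) = tgt f"
  "tgt (converse_arr f) = src f"
  "graph (converse_arr f) = (graph f)\<inverse>"
  "converse_arr (converse_arr f) = f"
  by (simp_all add: converse_arr_def)

lemma converse_arr_in_hom: "f \<in> hom FRel A B \<Longrightarrow> converse_arr f \<in> hom FRel B A"
  by (auto simp: in_hom_FRel)

lemma converse_arr_comp:
  "converse_arr (g \<cdot>\<^bsub>FRel\<^esub> f) = converse_arr f \<cdot>\<^bsub>FRel\<^esub> converse_arr g"
  by (rule rel_arr_eqI) auto

lemma converse_arr_tarr: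
  "converse_arr (f \<otimes>\<^bsub>FRel\<^esub> g) = converse_arr f \<otimes>\<^bsub>FRel\<^esub> converse_arr g"
  by (rule rel_arr_eqI) auto

lemma converse_arr_ident: "converse_arr (ident FRel A) = ident FRel A"
  by (rule rel_arr_eqI) auto

lemma converse_arr_discard: "converse_arr (discard A) = mixed A"
  by (rule rel_arr_eqI) (auto simp: discard_def mixed_def)

text \<open>Converse reverses composition, so it turns a square around: \<open>u\<close> and
  \<open>v\<close> trade places, and the converse of a filler is a filler.\<close>

lemma lifts_against_converse:
  assumes "lifts_against FRel f g"
  shows "lifts_against FRel (converse_arr g) (converse_arr f)"
  unfolding lifts_against_def
proof (intro ballI impI)
  fix u v
  assume u: "u \<in> hom FRel (dom FRel (converse_arr g)) (dom FRel (converse_arr f))"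
    and v: "v \<in> hom FRel (cod FRel (converse_arr g)) (cod FRel (converse_arr f))"
    and square: "converse_arr f \<cdot>\<^bsub>FRel\<^esub> u = v \<cdot>\<^bsub>FRel\<^esub> converse_arr g"
  have "g \<cdot>\<^bsub>FRel\<^esub> converse_arr v = converse_arr u \<cdot>\<^bsub>FRel\<^esub> f"
    using arg_cong[OF square, of converse_arr]
    unfolding converse_arr_comp converse_arr_simps(4) by (rule sym)
  moreover have "converse_arr v \<in> hom FRel (dom FRel f) (dom FRel g)"
    "converse_arr u \<in> hom FRel (cod FRel f) (cod FRel g)"
    using converse_arr_in_hom[OF u] converse_arr_in_hom[OF v] by simp_all
  ultimately obtain h where h: "h \<in> hom FRel (cod FRel f) (dom FRel g)"
    "h \<cdot>\<^bsub>FRel\<^esub> f = converse_arr v" "g \<cdot>\<^bsub>FRel\<^esub> h = converse_arr u"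
    using assms unfolding lifts_against_def by blast
  have "converse_arr h \<in> hom FRel (cod FRel (converse_arr g)) (dom FRel (converse_arr f))"
    using converse_arr_in_hom[OF h(1)] by simp
  moreover have "converse_arr h \<cdot>\<^bsub>FRel\<^esub> converse_arr g = u"
    "converse_arr f \<cdot>\<^bsub>FRel\<^esub> converse_arr h = v"
    unfolding converse_arr_comp[symmetric] h(2,3) by simp_all
  ultimately show "\<exists>h\<in>hom FRel (cod FRel (converse_arr g)) (dom FRel (converse_arr f)).
      h \<cdot>\<^bsub>FRel\<^esub> converse_arr g = u \<and> converse_arr f \<cdot>\<^bsub>FRel\<^esub> h = v"
    by blast
qed

lemma lifts_against_converse_iff:
  "lifts_against FRel (converse_arr g) (converse_arr f) \<longleftrightarrow> lifts_against FRel f g"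
  using lifts_against_converse[of f g] lifts_against_converse[of "converse_arr g" "converse_arr f"]
  by auto

text \<open>Converse preserves tensors and identities, so the two auxiliary objects merely swap
  roles.\<close>

lemma oslash_converse_iff:
  "oslash FRel (converse_arr g) (converse_arr f) \<longleftrightarrow> oslash FRel f g"
proof -
  have "lifts_against FRel (converse_arr g \<otimes>\<^bsub>FRel\<^esub> ident FRel B) (converse_arr f \<otimes>\<^bsub>FRel\<^esub> ident FRel A)
    \<longleftrightarrow> lifts_against FRel (f \<otimes>\<^bsub>FRel\<^esub> ident FRel A) (g \<otimes>\<^bsub>FRel\<^esub> ident FRel B)" for A B
    using lifts_against_converse_iff[of "g \<otimes>\<^bsub>FRel\<^esub> ident FRel B" "f \<otimes>\<^bsub>FRel\<^esub> ident FRel A"]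
    unfolding converse_arr_tarr converse_arr_ident .
  then show ?thesis unfolding oslash_def by blast
qed

text \<open>The converse of \<open>discard A\<close> is \<open>mixed A\<close> for the same
  \<open>A\<close>, so the characterisation of pure morphisms transfers to copure ones.\<close>

lemma copure_iff_converse_pure: "f \<in> copure \<longleftrightarrow> converse_arr f \<in> pure"
proof -
  have "oslash FRel f (discard A) \<longleftrightarrow> oslash FRel (mixed A) (converse_arr f)" for A
    using oslash_converse_iff[of "discard A" f] by (simp add: converse_arr_discard)
  then show ?thesis
    by (auto simp: copure_def pure_def left_oslash_def right_oslash_def discardings_def
        mixed_states_def)
qed

lemma injective_relations_iff_converse:
  "f \<in> injective_relations \<longleftrightarrow> converse_arr f \<in> partial_functions"
  by (auto simp: injective_relations_iff partial_functions_iff)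

theorem lemma14:
  shows "sym_monoidal_subcategory (FRel :: ('a elt set, 'a rel_arr) monoidal_data) pure \<and>
         (pure :: 'a rel_arr set) = partial_functions \<and>
         sym_monoidal_subcategory (FRel :: ('a elt set, 'a rel_arr) monoidal_data) copure \<and>
         (copure :: 'a rel_arr set) = injective_relations"
proof -
  have pure: "(pure :: 'a rel_arr set) = partial_functions"
    using partial_functions_subset_pure pure_subset_partial_functions by (rule equalityI[rotated])
  then have "(copure :: 'a rel_arr set) = injective_relations"
    by (auto simp: copure_iff_converse_pure injective_relations_iff_converse)
  with pure show ?thesis
    using sym_monoidal_subcategory_partial_functions sym_monoidal_subcategory_injective_relations
    by simp
qed

end
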